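(* Let $G$ be a finite, simple, connected $2K_2$-free graph. If there exists $k \in \{3,4,5\}$ such that $G$ has no induced cycle of length $k$, then $c(G) \leq 2$.
   Context: $2K_2$ denotes the graph consisting of two disjoint edges (the complement of the 4-cycle). A graph $G$ is $H$-free if it contains no induced subgraph isomorphic to $H$. The game of cops and robbers on $G$: $k$ cops each choose a starting vertex, then a single robber chooses a vertex; then players alternate turns starting with the cops. On the cops' turn each cop stays put or moves to an adjacent vertex; on the robber's turn he stays put or moves to an adjacent vertex. All moves are visible to both sides. The cops win if at some point a cop occupies the robber's vertex. The cop number $c(G)$ is the minimum number of cops for which the cops have a winning strategy on $G$. *)

theory Defs
  imports "Graph_Theory.Graph_Theory"
begin

text \<open>
  Finite simple graphs are represented by the locale predicate \<^const>\<open>graph\<close>: finite symmetric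
  digraphs without loops and parallel arcs, each edge being a pair of opposite arcs.
  \<^const>\<open>Digraph_Component.connected\<close> excludes the null graph.
\<close>

section \<open>Forbidden induced subgraphs\<close>

definition induced_free :: "('c, 'd) pre_digraph \<Rightarrow> ('a, 'b) pre_digraph \<Rightarrow> bool" where
  "induced_free H G \<longleftrightarrow> \<not> (\<exists>K. induced_subgraph K G \<and> digraph_iso K H)"

definition two_K2 :: "nat pair_pre_digraph" where
  "two_K2 = \<lparr> pverts = {0, 1, 2, 3}, parcs = {(0, 1), (1, 0), (2, 3), (3, 2)} \<rparr>"

text \<open>Only meaningful for \<open>n \<ge> 3\<close>.\<close>

definition cycle_graph :: "nat \<Rightarrow> nat pair_pre_digraph" where
  "cycle_graph n = \<lparr> pverts = {..<n},
     parcs = {(i, j). i < n \<and> j < n \<and> (j = Suc i mod n \<or> i = Suc j mod n)} \<rparr>"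

lemma pair_graph_two_K2: "pair_graph two_K2"
  by unfold_locales (auto simp: two_K2_def arcs_ends_conv symmetric_def sym_def)

lemma pair_graph_cycle_graph:
  assumes "n \<ge> 3"
  shows "pair_graph (cycle_graph n)"
proof unfold_locales
  show "finite (parcs (cycle_graph n))"
    by (rule finite_subset[of _ "{..<n} \<times> {..<n}"]) (auto simp: cycle_graph_def)
  show "fst e \<noteq> snd e" if "e \<in> parcs (cycle_graph n)" for e
    using that assms by (auto simp: cycle_graph_def mod_Suc split: if_splits)
qed (auto simp: cycle_graph_def symmetric_def sym_def)

section \<open>Cops and robbers\<close>

definition stay_or_move :: "('a, 'b) pre_digraph \<Rightarrow> 'a \<Rightarrow> 'a \<Rightarrow> bool" where
  "stay_or_move G u v \<longleftrightarrow> u = v \<or> u \<rightarrow>\<^bsub>G\<^esub> v"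

text \<open>\<open>r 0\<close> is the robber's starting vertex and \<open>r n\<close> his position after his \<open>n\<close>-th move.\<close>

definition robber_walk :: "('a, 'b) pre_digraph \<Rightarrow> (nat \<Rightarrow> 'a) \<Rightarrow> bool" where
  "robber_walk G r \<longleftrightarrow> r 0 \<in> verts G \<and> (\<forall>n. stay_or_move G (r n) (r (Suc n)))"

text \<open>
  A strategy for \<open>k\<close> cops maps the list of the robber's positions so far to the cops' next
  positions, cop \<open>i < k\<close> going to \<open>s h i\<close>. Thus \<open>s []\<close> is the initial placement, made before
  the robber chooses his vertex, and \<open>s [r 0, \<dots>, r (n - 1)]\<close> is the cops' position after their
  \<open>n\<close>-th move. The cops' own past moves are determined by \<open>s\<close> and need not be arguments.
  Play formally continues after a capture, where the cops can always stay put.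
\<close>

definition cop_strategy ::
    "('a, 'b) pre_digraph \<Rightarrow> nat \<Rightarrow> ('a list \<Rightarrow> nat \<Rightarrow> 'a) \<Rightarrow> bool" where
  "cop_strategy G k s \<longleftrightarrow>
     (\<forall>i<k. s [] i \<in> verts G) \<and>
     (\<forall>r. robber_walk G r \<longrightarrow>
        (\<forall>n. \<forall>i<k. stay_or_move G (s (map r [0..<n]) i) (s (map r [0..<Suc n]) i)))"

text \<open>
  The robber at \<open>r n\<close> is caught if he has just put himself on a cop (first disjunct) or a cop
  moves onto him in the following cops' turn (second disjunct).
\<close>

definition winning_cop_strategy ::
    "('a, 'b) pre_digraph \<Rightarrow> nat \<Rightarrow> ('a list \<Rightarrow> nat \<Rightarrow> 'a) \<Rightarrow> bool" where
  "winning_cop_strategy G k s \<longleftrightarrow>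
     cop_strategy G k s \<and>
     (\<forall>r. robber_walk G r \<longrightarrow>
        (\<exists>n. \<exists>i<k. s (map r [0..<n]) i = r n \<or> s (map r [0..<Suc n]) i = r n))"

definition cops_win :: "('a, 'b) pre_digraph \<Rightarrow> nat \<Rightarrow> bool" where
  "cops_win G k \<longleftrightarrow> (\<exists>s. winning_cop_strategy G k s)"

definition cop_number :: "('a, 'b) pre_digraph \<Rightarrow> nat" where
  "cop_number G = (LEAST k. cops_win G k)"

text \<open>The minimum is attained on every finite graph: put a cop on each vertex.\<close>

lemma cops_win_card_verts:
  assumes "finite (verts G)"
  shows "cops_win G (card (verts G))"
proof -
  obtain f where f: "bij_betw f {0..<card (verts G)} (verts G)"
    using ex_bij_betw_nat_finite[OF assms] by blast
  then have im: "f ` {0..<card (verts G)} = verts G"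
    by (rule bij_betw_imp_surj_on)
  have "winning_cop_strategy G (card (verts G)) (\<lambda>_. f)"
    unfolding winning_cop_strategy_def cop_strategy_def
  proof (intro conjI allI impI)
    fix r assume "robber_walk G r"
    then have "r 0 \<in> f ` {0..<card (verts G)}"
      unfolding im by (simp add: robber_walk_def)
    then obtain i where "i < card (verts G)" "f i = r 0"
      by auto
    then show "\<exists>n. \<exists>i<card (verts G). f i = r n \<or> f i = r n"
      by blast
  qed (use im in \<open>auto simp: stay_or_move_def\<close>)
  then show ?thesis
    unfolding cops_win_def by blast
qed

lemma cops_win_cop_number:
  assumes "finite (verts G)"
  shows "cops_win G (cop_number G)"
  unfolding cop_number_def by (rule LeastI) (rule cops_win_card_verts[OF assms])

end

theory Submission
  imports Defs
begin

text \<open>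
  The cops start on the two ends \<open>u\<close>, \<open>v\<close> of an edge. If the robber starts at \<open>r\<close>, not adjacent
  to either, then \<open>2K\<^sub>2\<close>-freeness forces every neighbour of \<open>r\<close> to be adjacent to \<open>u\<close> or to \<open>v\<close>.
  Moving the cop on \<open>u\<close> to a common neighbour \<open>x\<close> of \<open>r\<close> and \<open>u\<close> attacks the robber, and the other
  cop has to cover his escapes. If \<open>u\<close> alone dominates the neighbourhood of \<open>r\<close>, this cop moves
  to \<open>u\<close>; so let \<open>x\<close> be nonadjacent to \<open>v\<close>. Without induced 4-cycles the common neighbours of \<open>r\<close>
  and \<open>u\<close> form a clique, and the cop on \<open>v\<close> can stay. Without induced 5-cycles \<open>x\<close> is adjacent
  to all neighbours of \<open>r\<close> that \<open>u\<close> misses, and the cop on \<open>v\<close> moves to \<open>u\<close>. Without triangles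
  he stays on \<open>v\<close>: the robber can only escape to a twin of \<open>x\<close>, where he is caught once this
  cop has moved to \<open>u\<close>.
\<close>

section \<open>Winning positions\<close>

definition cops_move :: "('a, 'b) pre_digraph \<Rightarrow> nat \<Rightarrow> (nat \<Rightarrow> 'a) \<Rightarrow> (nat \<Rightarrow> 'a) \<Rightarrow> bool" where
  "cops_move G k p p' \<longleftrightarrow> (\<forall>i<k. stay_or_move G (p i) (p' i))"

text \<open>The cops are to move, and \<open>n\<close> bounds their remaining turns. A robber who
  steps onto a cop is caught at the next turn, when that cop stays put. The bound serves as a rank
  that decreases along play.\<close>

primrec catch_within :: "('a, 'b) pre_digraph \<Rightarrow> nat \<Rightarrow> nat \<Rightarrow> (nat \<Rightarrow> 'a) \<Rightarrow> 'a \<Rightarrow> bool" where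
  "catch_within G k 0 p r \<longleftrightarrow> False"
| "catch_within G k (Suc n) p r \<longleftrightarrow>
     (\<exists>p'. cops_move G k p p' \<and>
       ((\<exists>i<k. p' i = r) \<or> (\<forall>r'. stay_or_move G r r' \<longrightarrow> catch_within G k n p' r')))"

text \<open>One positional choice that is good for all \<open>n\<close> at once, since the strategy
  built in \<open>cops_winI\<close> does not carry a remaining bound along. \<open>cops_move\<close>
  stands outside the implication, so the move is legal in positions that are not winning
  too.\<close>

definition best_move :: "('a, 'b) pre_digraph \<Rightarrow> nat \<Rightarrow> (nat \<Rightarrow> 'a) \<Rightarrow> 'a \<Rightarrow> (nat \<Rightarrow> 'a)" where
  "best_move G k p r = (SOME p'. cops_move G k p p' \<and>
     (\<forall>n. catch_within G k n p r \<longrightarrow> (\<exists>i<k. p' i = r) \<or>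
       (\<exists>m<n. \<forall>r'. stay_or_move G r r' \<longrightarrow> catch_within G k m p' r')))"

lemma best_move:
  shows cops_move_best_move: "cops_move G k p (best_move G k p r)" (is ?move)
    and best_move_progress: "catch_within G k n p r \<Longrightarrow> (\<exists>i<k. best_move G k p r i = r) \<or>
      (\<exists>m<n. \<forall>r'. stay_or_move G r r' \<longrightarrow> catch_within G k m (best_move G k p r) r')"
proof -
  have "\<exists>p'. cops_move G k p p' \<and>
     (\<forall>n. catch_within G k n p r \<longrightarrow> (\<exists>i<k. p' i = r) \<or>
       (\<exists>m<n. \<forall>r'. stay_or_move G r r' \<longrightarrow> catch_within G k m p' r'))"
  proof (cases "\<exists>n. catch_within G k n p r")
    case False
    then show ?thesis
      by (intro exI[of _ p]) (auto simp: cops_move_def stay_or_move_def)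
  next
    case True
    \<comment> \<open>A move that is good for the least \<open>n\<close> is good for all \<open>n\<close>.\<close>
    define n where "n = (LEAST n. catch_within G k n p r)"
    have "catch_within G k n p r"
      unfolding n_def using True by (rule LeastI_ex)
    moreover have least: "n \<le> n'" if "catch_within G k n' p r" for n'
      unfolding n_def using that by (rule Least_le)
    ultimately obtain m p' where "n = Suc m" "cops_move G k p p'"
      "(\<exists>i<k. p' i = r) \<or> (\<forall>r'. stay_or_move G r r' \<longrightarrow> catch_within G k m p' r')"
      by (cases n) auto
    with least show ?thesis
      by (metis Suc_le_lessD)
  qed
  from someI_ex[OF this]
  show ?move "catch_within G k n p r \<Longrightarrow> (\<exists>i<k. best_move G k p r i = r) \<or>
      (\<exists>m<n. \<forall>r'. stay_or_move G r r' \<longrightarrow> catch_within G k m (best_move G k p r) r')"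
    unfolding best_move_def by blast+
qed

text \<open>Play \<open>best_move\<close> in every round: the bound in \<open>catch_within\<close>
  drops strictly until a capture, and it cannot drop forever.\<close>

lemma cops_winI:
  assumes start: "\<And>i. i < k \<Longrightarrow> p i \<in> verts G"
    and catch: "\<And>r. r \<in> verts G \<Longrightarrow> \<exists>n. catch_within G k n p r"
  shows "cops_win G k"
proof -
  \<comment> \<open>Folding over the robber's positions gives \<open>s [] = p\<close> and one
    \<open>best_move\<close> per position.\<close>
  define s where "s = foldl (best_move G k) p"
  have s_Suc: "s (map r [0..<Suc n]) = best_move G k (s (map r [0..<n])) (r n)" for r n
    by (simp add: s_def)
  have "\<exists>n. \<exists>i<k. s (map r [0..<Suc n]) i = r n" if walk: "robber_walk G r" for r
  proof -
    have "catch_within G k n (s (map r [0..<t])) (r t) \<Longrightarrow>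
        \<exists>t. \<exists>i<k. s (map r [0..<Suc t]) i = r t" for n t
    \<comment> \<open>Strong induction, because \<open>best_move\<close> promises only some smaller
      bound.\<close>
    proof (induction n arbitrary: t rule: less_induct)
      case (less n)
      from best_move_progress[OF less.prems] show ?case
        unfolding s_Suc[symmetric]
      proof (elim disjE exE conjE)
        fix m
        assume "m < n" "\<forall>r'. stay_or_move G (r t) r' \<longrightarrow> catch_within G k m (s (map r [0..<Suc t])) r'"
        then show ?thesis
          using walk less.IH[of m "Suc t"] unfolding robber_walk_def by blast
      qed blast
    qed
    moreover obtain n where "catch_within G k n p (r 0)"
      using catch walk unfolding robber_walk_def by blast
    ultimately show ?thesis
      by (metis foldl_Nil list.map(1) s_def upt_0)
  qed
  moreover have "cop_strategy G k s"
    unfolding cop_strategy_def s_Suc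
    using start cops_move_best_move[of G k] by (auto simp: s_def cops_move_def)
  ultimately show ?thesis
    unfolding cops_win_def winning_cop_strategy_def by blast
qed

section \<open>Positions of two cops\<close>

definition two_cops :: "'a \<Rightarrow> 'a \<Rightarrow> nat \<Rightarrow> 'a" where
  "two_cops a b i = (if i = 0 then a else b)"

lemma catch_within_two_cops_swap:
  "catch_within G 2 n (two_cops a b) r \<Longrightarrow> catch_within G 2 n (two_cops b a) r"
proof -
  \<comment> \<open>Truncated subtraction makes \<open>1 - i\<close> exchange 0 and 1. The claim is
    for arbitrary \<open>p\<close>, because intermediate positions are unconstrained beyond index 1
    and need not have the form \<open>two_cops\<close>.\<close>
  have "catch_within G 2 n p r \<Longrightarrow> catch_within G 2 n (\<lambda>i. p (1 - i)) r" for p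
  proof (induction n arbitrary: p r)
    case (Suc n)
    then obtain p' where p': "cops_move G 2 p p'"
      "(\<exists>i<2. p' i = r) \<or> (\<forall>r'. stay_or_move G r r' \<longrightarrow> catch_within G 2 n p' r')"
      by auto
    have "cops_move G 2 (\<lambda>i. p (1 - i)) (\<lambda>i. p' (1 - i))"
      using p'(1) by (auto simp: cops_move_def)
    moreover have "(\<exists>i<2. p' (1 - i) = r) \<or>
        (\<forall>r'. stay_or_move G r r' \<longrightarrow> catch_within G 2 n (\<lambda>i. p' (1 - i)) r')"
      using p'(2)
    proof (elim disjE exE conjE)
      fix i :: nat assume "i < 2" "p' i = r"
      then have "1 - i < 2 \<and> p' (1 - (1 - i)) = r"
        by (cases i) auto
      then show ?thesis by blast
    qed (use Suc.IH in blast)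
    ultimately show ?case
      by auto
  qed simp
  moreover have "(\<lambda>i. two_cops a b (1 - i)) = two_cops b a"
    by (auto simp: two_cops_def fun_eq_iff)
  ultimately show "catch_within G 2 n (two_cops a b) r \<Longrightarrow> catch_within G 2 n (two_cops b a) r"
    by metis
qed

text \<open>The arbitrary \<open>n\<close>, here and below, lets pursuits of different lengths be
  combined under one bound.\<close>

lemma catch_within_two_cops_attacked:
  assumes "stay_or_move G a r \<or> stay_or_move G b r"
  shows "catch_within G 2 (Suc n) (two_cops a b) r"
proof -
  from assms consider "stay_or_move G a r" | "stay_or_move G b r" by blast
  then show ?thesis
  proof cases
    case 1
    then have "cops_move G 2 (two_cops a b) (two_cops r b)"
      by (auto simp: cops_move_def two_cops_def stay_or_move_def)
    then show ?thesis
      by (auto simp: two_cops_def intro!: exI[of _ "two_cops r b"] exI[of _ "0::nat"])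
  next
    case 2
    then have "cops_move G 2 (two_cops a b) (two_cops a r)"
      by (auto simp: cops_move_def two_cops_def stay_or_move_def)
    then show ?thesis
      by (auto simp: two_cops_def intro!: exI[of _ "two_cops a r"] exI[of _ "1::nat"])
  qed
qed

lemma catch_within_two_cops_step:
  assumes "stay_or_move G a a'" "stay_or_move G b b'"
    and "\<And>r'. stay_or_move G r r' \<Longrightarrow> catch_within G 2 n (two_cops a' b') r'"
  shows "catch_within G 2 (Suc n) (two_cops a b) r"
proof -
  have "cops_move G 2 (two_cops a b) (two_cops a' b')"
    using assms(1,2) by (auto simp: cops_move_def two_cops_def)
  then show ?thesis
    using assms(3) by auto
qed

lemma catch_within_two_cops_trapped:
  assumes "stay_or_move G a a'" "stay_or_move G b b'"
    and "\<And>r'. stay_or_move G r r' \<Longrightarrow> stay_or_move G a' r' \<or> stay_or_move G b' r'"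
  shows "catch_within G 2 (Suc (Suc n)) (two_cops a b) r"
  using assms by (intro catch_within_two_cops_step catch_within_two_cops_attacked)

section \<open>Forbidden configurations\<close>

text \<open>The inverse of the embedding \<open>f\<close> is an isomorphism onto \<open>H\<close>
  from the subgraph induced on the image of \<open>f\<close>. Arcs of \<open>G\<close> have an
  abstract type, so each is sent to the pair of preimages of its ends; this is injective because
  there are no parallel arcs.\<close>

lemma (in nomulti_digraph) not_induced_free:
  assumes inj: "inj_on f (pverts H)" and vert: "f ` pverts H \<subseteq> verts G"
    and H: "parcs H \<subseteq> pverts H \<times> pverts H"
    and adj: "\<And>i j. i \<in> pverts H \<Longrightarrow> j \<in> pverts H \<Longrightarrow> (i, j) \<in> parcs H \<longleftrightarrow> f i \<rightarrow>\<^bsub>G\<^esub> f j"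
  shows "\<not> induced_free (with_proj H) G"
proof -
  let ?K = "G \<restriction> (f ` pverts H)" and ?g = "the_inv_into (pverts H) f"
  let ?h = "\<lparr>iso_verts = ?g, iso_arcs = (\<lambda>e. (?g (tail G e), ?g (head G e))),
    iso_head = snd, iso_tail = fst\<rparr>"
  have g: "?g (f i) = i" if "i \<in> pverts H" for i
    using inj that by (rule the_inv_into_f_f)
  have "inj_on (\<lambda>e. (?g (tail G e), ?g (head G e))) (arcs ?K)"
  proof (rule inj_onI)
    fix d e assume "d \<in> arcs ?K" "e \<in> arcs ?K"
      "(?g (tail G d), ?g (head G d)) = (?g (tail G e), ?g (head G e))"
    then show "d = e"
      by (intro no_multi_arcs) (auto simp: arc_to_ends_def g)
  qed
  then have "pre_digraph.digraph_isomorphism ?K ?h"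
    using inj vert by (auto simp: pre_digraph.digraph_isomorphism_def g inj_on_the_inv_into)
  moreover have "parcs H = (\<lambda>e. (?g (tail G e), ?g (head G e))) ` arcs ?K"
  proof (intro set_eqI iffI)
    fix a assume a: "a \<in> parcs H"
    then obtain i j where ij: "a = (i, j)" "i \<in> pverts H" "j \<in> pverts H"
      using H by auto
    then obtain e where "e \<in> arcs G" "tail G e = f i" "head G e = f j"
      using a adj by (auto simp: arcs_ends_conv)
    with ij show "a \<in> (\<lambda>e. (?g (tail G e), ?g (head G e))) ` arcs ?K"
      by (auto simp: g intro!: image_eqI[of _ _ e])
  next
    fix a assume "a \<in> (\<lambda>e. (?g (tail G e), ?g (head G e))) ` arcs ?K"
    then obtain e i j where e: "e \<in> arcs G" "tail G e = f i" "head G e = f j"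
      "i \<in> pverts H" "j \<in> pverts H" "a = (?g (tail G e), ?g (head G e))"
      by auto
    then have "f i \<rightarrow>\<^bsub>G\<^esub> f j"
      by (auto simp: arcs_ends_conv image_iff intro!: bexI[of _ e])
    with e show "a \<in> parcs H"
      by (simp add: g adj)
  qed
  then have "with_proj H = app_iso ?h ?K"
    by (auto simp: app_iso_def with_proj_def image_image g)
  moreover have "induced_subgraph ?K G"
    using vert by (rule induced_induce)
  ultimately show ?thesis
    unfolding induced_free_def digraph_iso_def by blast
qed

section \<open>Adjacencies forced by forbidden subgraphs\<close>

context graph
begin

lemma dominates_sym: "u \<rightarrow>\<^bsub>G\<^esub> v \<longleftrightarrow> v \<rightarrow>\<^bsub>G\<^esub> u"
  using sym_arcs by (auto simp: symmetric_def sym_def)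

lemma not_dominates_self: "\<not> u \<rightarrow>\<^bsub>G\<^esub> u"
  by (auto simp: arcs_ends_conv dest: no_loops)

text \<open>Both graphs are symmetric and loopless, so it is enough to compare adjacency for
  \<open>i < j\<close>. For a concrete list this unfolds into finitely many conditions.\<close>

lemma not_induced_free_list:
  assumes "pair_graph H" and pverts: "pverts H = {..<length xs}"
    and "distinct xs" "set xs \<subseteq> verts G"
    and adj: "\<forall>j<length xs. \<forall>i<j. (i, j) \<in> parcs H \<longleftrightarrow> xs ! i \<rightarrow>\<^bsub>G\<^esub> xs ! j"
  shows "\<not> induced_free (with_proj H) G"
proof -
  interpret H: pair_graph H by fact
  show ?thesis
  proof (rule not_induced_free)
    show "inj_on ((!) xs) (pverts H)"
      using assms by (auto intro: inj_on_nth)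
    show "(!) xs ` pverts H \<subseteq> verts G"
      using assms by auto
    show "parcs H \<subseteq> pverts H \<times> pverts H"
      by (auto dest: H.in_arcsD1 H.in_arcsD2)
    fix i j assume ij: "i \<in> pverts H" "j \<in> pverts H"
    have "(i, j) \<in> parcs H \<longleftrightarrow> (j, i) \<in> parcs H"
      using H.arcs_symmetric by blast
    moreover have "(i, i) \<notin> parcs H"
      using H.no_loops' by blast
    ultimately show "(i, j) \<in> parcs H \<longleftrightarrow> xs ! i \<rightarrow>\<^bsub>G\<^esub> xs ! j"
      using ij adj not_dominates_self dominates_sym[of "xs ! i" "xs ! j"]
      unfolding pverts by (cases i j rule: linorder_cases) auto
  qed
qed

lemma two_K2_freeD:
  assumes "induced_free (with_proj two_K2) G" "a \<rightarrow>\<^bsub>G\<^esub> b" "c \<rightarrow>\<^bsub>G\<^esub> d"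
    and "a \<noteq> c" "a \<noteq> d" "b \<noteq> c" "b \<noteq> d"
  shows "a \<rightarrow>\<^bsub>G\<^esub> c \<or> a \<rightarrow>\<^bsub>G\<^esub> d \<or> b \<rightarrow>\<^bsub>G\<^esub> c \<or> b \<rightarrow>\<^bsub>G\<^esub> d"
proof (rule ccontr)
  assume "\<not> ?thesis"
  with assms(2-) have "\<not> induced_free (with_proj two_K2) G"
    by (intro not_induced_free_list[OF pair_graph_two_K2, of "[a, b, c, d]"])
      (auto simp: two_K2_def All_less_Suc not_dominates_self dest: adj_in_verts)
  with assms(1) show False by blast
qed

lemma triangle_freeD:
  assumes "induced_free (with_proj (cycle_graph 3)) G" "a \<rightarrow>\<^bsub>G\<^esub> b" "b \<rightarrow>\<^bsub>G\<^esub> c"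
  shows "\<not> a \<rightarrow>\<^bsub>G\<^esub> c"
proof
  assume "a \<rightarrow>\<^bsub>G\<^esub> c"
  with assms(2-) have "\<not> induced_free (with_proj (cycle_graph 3)) G"
    by (intro not_induced_free_list[OF pair_graph_cycle_graph, of 3 "[a, b, c]"])
      (auto simp: cycle_graph_def All_less_Suc mod_Suc not_dominates_self dest: adj_in_verts)
  with assms(1) show False by blast
qed

text \<open>The closing edge is written from \<open>a\<close> to match the pairs
  \<open>i < j\<close> in \<open>not_induced_free_list\<close>. Opposite vertices get explicit
  inequalities; adjacent ones differ since \<open>G\<close> has no loops.\<close>

lemma four_cycle_freeD:
  assumes "induced_free (with_proj (cycle_graph 4)) G"
    and "a \<rightarrow>\<^bsub>G\<^esub> b" "b \<rightarrow>\<^bsub>G\<^esub> c" "c \<rightarrow>\<^bsub>G\<^esub> d" "a \<rightarrow>\<^bsub>G\<^esub> d" "a \<noteq> c" "b \<noteq> d"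
  shows "a \<rightarrow>\<^bsub>G\<^esub> c \<or> b \<rightarrow>\<^bsub>G\<^esub> d"
proof (rule ccontr)
  assume "\<not> ?thesis"
  with assms(2-) have "\<not> induced_free (with_proj (cycle_graph 4)) G"
    by (intro not_induced_free_list[OF pair_graph_cycle_graph, of 4 "[a, b, c, d]"])
      (auto simp: cycle_graph_def All_less_Suc mod_Suc not_dominates_self dest: adj_in_verts)
  with assms(1) show False by blast
qed

lemma five_cycle_freeD:
  assumes "induced_free (with_proj (cycle_graph 5)) G"
    and "a \<rightarrow>\<^bsub>G\<^esub> b" "b \<rightarrow>\<^bsub>G\<^esub> c" "c \<rightarrow>\<^bsub>G\<^esub> d" "d \<rightarrow>\<^bsub>G\<^esub> e" "a \<rightarrow>\<^bsub>G\<^esub> e"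
    and "a \<noteq> c" "a \<noteq> d" "b \<noteq> d" "b \<noteq> e" "c \<noteq> e"
  shows "a \<rightarrow>\<^bsub>G\<^esub> c \<or> a \<rightarrow>\<^bsub>G\<^esub> d \<or> b \<rightarrow>\<^bsub>G\<^esub> d \<or> b \<rightarrow>\<^bsub>G\<^esub> e \<or> c \<rightarrow>\<^bsub>G\<^esub> e"
proof (rule ccontr)
  assume "\<not> ?thesis"
  with assms(2-) have "\<not> induced_free (with_proj (cycle_graph 5)) G"
    by (intro not_induced_free_list[OF pair_graph_cycle_graph, of 5 "[a, b, c, d, e]"])
      (auto simp: cycle_graph_def All_less_Suc mod_Suc not_dominates_self dest: adj_in_verts)
  with assms(1) show False by blast
qed

section \<open>Catching the robber\<close>

text \<open>Otherwise the edges \<open>u v\<close> and \<open>r w\<close> would induce 2K_2;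
  \<open>w\<close> is neither \<open>u\<close> nor \<open>v\<close>, as these are not adjacent to
  \<open>r\<close>.\<close>

lemma neighbour_of_robber_attacked:
  assumes "induced_free (with_proj two_K2) G" "u \<rightarrow>\<^bsub>G\<^esub> v"
    and "\<not> stay_or_move G u r" "\<not> stay_or_move G v r" "r \<rightarrow>\<^bsub>G\<^esub> w"
  shows "u \<rightarrow>\<^bsub>G\<^esub> w \<or> v \<rightarrow>\<^bsub>G\<^esub> w"
proof (rule ccontr)
  assume "\<not> (u \<rightarrow>\<^bsub>G\<^esub> w \<or> v \<rightarrow>\<^bsub>G\<^esub> w)"
  moreover have "w \<noteq> u" "w \<noteq> v"
    using assms dominates_sym[of r] by (auto simp: stay_or_move_def)
  ultimately show False
    using two_K2_freeD[OF assms(1,2,5)] assms(3,4) by (auto simp: stay_or_move_def)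
qed

lemma catch_four_cycle_free:
  assumes "induced_free (with_proj two_K2) G"
    and C4: "induced_free (with_proj (cycle_graph 4)) G"
    and "u \<rightarrow>\<^bsub>G\<^esub> v" "\<not> stay_or_move G u r" "\<not> stay_or_move G v r" "r \<rightarrow>\<^bsub>G\<^esub> x" "u \<rightarrow>\<^bsub>G\<^esub> x"
  shows "catch_within G 2 (Suc (Suc n)) (two_cops u v) r"
proof (rule catch_within_two_cops_trapped)
  show "stay_or_move G u x" "stay_or_move G v v"
    using assms by (auto simp: stay_or_move_def)
  fix r' assume r': "stay_or_move G r r'"
  show "stay_or_move G x r' \<or> stay_or_move G v r'"
  proof (cases "r' = r \<or> r' = x \<or> v \<rightarrow>\<^bsub>G\<^esub> r'")
    case True
    then show ?thesis
      using assms dominates_sym[of x r] by (auto simp: stay_or_move_def)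
  next
    case False
    then have "r \<rightarrow>\<^bsub>G\<^esub> r'"
      using r' by (auto simp: stay_or_move_def)
    moreover from this have "u \<rightarrow>\<^bsub>G\<^esub> r'"
      using False neighbour_of_robber_attacked[OF assms(1,3,4,5)] by blast
    \<comment> \<open>The 4-cycle \<open>u\<close>, \<open>x\<close>, \<open>r\<close>,
      \<open>r'\<close> lacks the chord \<open>u r\<close>, hence has the chord
      \<open>x r'\<close>.\<close>
    ultimately have "x \<rightarrow>\<^bsub>G\<^esub> r'"
      using four_cycle_freeD[OF C4, of u x r r'] False assms(4,6,7) dominates_sym[of x r]
      by (auto simp: stay_or_move_def)
    then show ?thesis
      by (simp add: stay_or_move_def)
  qed
qed

lemma catch_five_cycle_free:
  assumes "induced_free (with_proj two_K2) G"
    and C5: "induced_free (with_proj (cycle_graph 5)) G"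
    and "u \<rightarrow>\<^bsub>G\<^esub> v" "\<not> stay_or_move G u r" "\<not> stay_or_move G v r"
    and "r \<rightarrow>\<^bsub>G\<^esub> x" "u \<rightarrow>\<^bsub>G\<^esub> x" "\<not> v \<rightarrow>\<^bsub>G\<^esub> x"
  shows "catch_within G 2 (Suc (Suc n)) (two_cops u v) r"
proof (rule catch_within_two_cops_trapped)
  show "stay_or_move G u x" "stay_or_move G v u"
    using assms dominates_sym[of u v] by (auto simp: stay_or_move_def)
  fix r' assume r': "stay_or_move G r r'"
  show "stay_or_move G x r' \<or> stay_or_move G u r'"
  proof (cases "r' = r \<or> r' = x \<or> u \<rightarrow>\<^bsub>G\<^esub> r'")
    case True
    then show ?thesis
      using assms dominates_sym[of x r] by (auto simp: stay_or_move_def)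
  next
    case False
    then have "r \<rightarrow>\<^bsub>G\<^esub> r'"
      using r' by (auto simp: stay_or_move_def)
    moreover from this have "v \<rightarrow>\<^bsub>G\<^esub> r'"
      using False neighbour_of_robber_attacked[OF assms(1,3,4,5)] by blast
    \<comment> \<open>In the 5-cycle \<open>r\<close>, \<open>x\<close>, \<open>u\<close>,
      \<open>v\<close>, \<open>r'\<close> every chord but \<open>x r'\<close> is excluded:
      \<open>r\<close> is adjacent to neither \<open>u\<close> nor \<open>v\<close>,
      \<open>x\<close> is not adjacent to \<open>v\<close>, and \<open>u\<close> misses
      \<open>r'\<close>.\<close>
    ultimately have "x \<rightarrow>\<^bsub>G\<^esub> r'"
      using five_cycle_freeD[OF C5, of r x u v r'] False assms(3-8)
        dominates_sym[of x u] dominates_sym[of r u] dominates_sym[of r v]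
        dominates_sym[of x v]
      by (auto simp: stay_or_move_def)
    then show ?thesis
      by (simp add: stay_or_move_def)
  qed
qed

text \<open>From \<open>x\<close> one cop attacks \<open>r\<close> itself, while the other, moving
  from \<open>v\<close> to \<open>u\<close>, covers every neighbour of \<open>r\<close>.\<close>

lemma catch_dominated:
  assumes "u \<rightarrow>\<^bsub>G\<^esub> v" "r \<rightarrow>\<^bsub>G\<^esub> x" "\<And>w. r \<rightarrow>\<^bsub>G\<^esub> w \<Longrightarrow> u \<rightarrow>\<^bsub>G\<^esub> w"
  shows "catch_within G 2 (Suc (Suc n)) (two_cops u v) r"
  by (rule catch_within_two_cops_trapped[where a' = x and b' = u])
    (use assms dominates_sym[of x r] dominates_sym[of u v] in \<open>auto simp: stay_or_move_def\<close>)

text \<open>If \<open>x\<close> missed \<open>w\<close>, an induced 2K_2 would appear, with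
  triangle-freeness supplying most of the nonadjacencies. Exchanging \<open>x\<close> and
  \<open>x'\<close> gives the reverse inclusion of neighbourhoods, so the two are twins.\<close>

lemma triangle_free_twins:
  assumes free: "induced_free (with_proj two_K2) G"
    and C3: "induced_free (with_proj (cycle_graph 3)) G"
    and "u \<rightarrow>\<^bsub>G\<^esub> v" "\<not> stay_or_move G u r" "\<not> stay_or_move G v r"
    and "r \<rightarrow>\<^bsub>G\<^esub> x" "u \<rightarrow>\<^bsub>G\<^esub> x" "r \<rightarrow>\<^bsub>G\<^esub> y" "v \<rightarrow>\<^bsub>G\<^esub> y" "r \<rightarrow>\<^bsub>G\<^esub> x'" "u \<rightarrow>\<^bsub>G\<^esub> x'" "x' \<rightarrow>\<^bsub>G\<^esub> w"
  shows "x \<rightarrow>\<^bsub>G\<^esub> w"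
proof (rule ccontr)
  assume w: "\<not> x \<rightarrow>\<^bsub>G\<^esub> w"
  have tri: False if "a \<rightarrow>\<^bsub>G\<^esub> b" "b \<rightarrow>\<^bsub>G\<^esub> c" "a \<rightarrow>\<^bsub>G\<^esub> c" for a b c
    using triangle_freeD[OF C3] that by blast
  have non: "\<not> r \<rightarrow>\<^bsub>G\<^esub> w" "\<not> u \<rightarrow>\<^bsub>G\<^esub> w" "\<not> x' \<rightarrow>\<^bsub>G\<^esub> y" "\<not> x \<rightarrow>\<^bsub>G\<^esub> y" "\<not> x' \<rightarrow>\<^bsub>G\<^esub> v" "\<not> x \<rightarrow>\<^bsub>G\<^esub> v" "\<not> u \<rightarrow>\<^bsub>G\<^esub> y"
    using tri[of r x' w] tri[of u x' w] tri[of r x' y] tri[of r x y] tri[of u x' v] tri[of u x v]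
      tri[of u v y] assms by blast+
  have far: "\<not> u \<rightarrow>\<^bsub>G\<^esub> r" "\<not> v \<rightarrow>\<^bsub>G\<^esub> r" "u \<noteq> r" "v \<noteq> r"
    using assms(4,5) by (auto simp: stay_or_move_def)
  show False
  proof (cases "v \<rightarrow>\<^bsub>G\<^esub> w")
    case True
    then have "v \<noteq> x" "w \<noteq> r" "w \<noteq> x"
      using assms non far by auto
    \<comment> \<open>The edges \<open>v w\<close> and \<open>r x\<close> would induce 2K_2.\<close>
    then show False
      using two_K2_freeD[OF free True \<open>r \<rightarrow>\<^bsub>G\<^esub> x\<close>] far non w
      by (auto simp: dominates_sym[of v x] dominates_sym[of w x] dominates_sym[of w r])
  next
    case False
    have "w \<noteq> u"
      using w assms dominates_sym[of x u] by blast
    have "x' \<noteq> v" "x' \<noteq> y" "w \<noteq> v" "w \<noteq> y"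
      using assms non far by (auto simp: dominates_sym)
    \<comment> \<open>Applied to the edges \<open>x' w\<close> and \<open>v y\<close>, 2K_2-freeness
      forces \<open>w y\<close> to be an edge. Then \<open>w y\<close> and \<open>u x\<close> would
      induce 2K_2.\<close>
    then have "w \<rightarrow>\<^bsub>G\<^esub> y"
      using two_K2_freeD[OF free \<open>x' \<rightarrow>\<^bsub>G\<^esub> w\<close> \<open>v \<rightarrow>\<^bsub>G\<^esub> y\<close>] non False
      by (auto simp: dominates_sym[of w v])
    moreover have "w \<noteq> x" "y \<noteq> u" "y \<noteq> x"
      using assms non far by (auto simp: dominates_sym)
    ultimately show False
      using two_K2_freeD[OF free \<open>w \<rightarrow>\<^bsub>G\<^esub> y\<close> \<open>u \<rightarrow>\<^bsub>G\<^esub> x\<close>] non w \<open>w \<noteq> u\<close>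
      by (auto simp: dominates_sym[of w u] dominates_sym[of y u] dominates_sym[of w x] dominates_sym[of y x])
  qed
qed

lemma catch_triangle_free:
  assumes free: "induced_free (with_proj two_K2) G"
    and C3: "induced_free (with_proj (cycle_graph 3)) G"
    and uv: "u \<rightarrow>\<^bsub>G\<^esub> v" and far: "\<not> stay_or_move G u r" "\<not> stay_or_move G v r"
    and x: "r \<rightarrow>\<^bsub>G\<^esub> x" "u \<rightarrow>\<^bsub>G\<^esub> x" and y: "r \<rightarrow>\<^bsub>G\<^esub> y" "v \<rightarrow>\<^bsub>G\<^esub> y"
  shows "catch_within G 2 (Suc (Suc (Suc n))) (two_cops u v) r"
proof (rule catch_within_two_cops_step)
  show "stay_or_move G u x" "stay_or_move G v v"
    using x by (auto simp: stay_or_move_def)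
  fix r' assume r': "stay_or_move G r r'"
  show "catch_within G 2 (Suc (Suc n)) (two_cops x v) r'"
  proof (cases "r' = r \<or> v \<rightarrow>\<^bsub>G\<^esub> r'")
    case True
    then show ?thesis
      using x dominates_sym[of x r]
      by (intro catch_within_two_cops_attacked) (auto simp: stay_or_move_def)
  next
    case False
    then have "r \<rightarrow>\<^bsub>G\<^esub> r'"
      using r' by (auto simp: stay_or_move_def)
    moreover from this have "u \<rightarrow>\<^bsub>G\<^esub> r'"
      using False neighbour_of_robber_attacked[OF free uv far] by blast
    ultimately have "x \<rightarrow>\<^bsub>G\<^esub> w" if "r' \<rightarrow>\<^bsub>G\<^esub> w" for w
      using triangle_free_twins[OF free C3 uv far x y _ _ that] by blast
    \<comment> \<open>Second turn: the cop on \<open>x\<close> stays and the one on \<open>v\<close>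
      moves to \<open>u\<close>. Now \<open>u\<close> attacks \<open>r'\<close> and \<open>x\<close>
      attacks all neighbours of \<open>r'\<close>.\<close>
    then show ?thesis
      using uv \<open>u \<rightarrow>\<^bsub>G\<^esub> r'\<close> dominates_sym[of u v]
      by (intro catch_within_two_cops_trapped[where a' = x and b' = u])
        (auto simp: stay_or_move_def)
  qed
qed

section \<open>Combining the cases\<close>

lemma catch_from_edge:
  assumes free: "induced_free (with_proj two_K2) G"
    and cyc: "\<exists>k\<in>{3, 4, 5}. induced_free (with_proj (cycle_graph k)) G"
    and uv: "u \<rightarrow>\<^bsub>G\<^esub> v" and nbr: "\<exists>x. r \<rightarrow>\<^bsub>G\<^esub> x"
  shows "catch_within G 2 (Suc (Suc (Suc n))) (two_cops u v) r"
proof (cases "stay_or_move G u r \<or> stay_or_move G v r")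
  case True
  then show ?thesis
    by (rule catch_within_two_cops_attacked)
next
  case False
  then have far: "\<not> stay_or_move G u r" "\<not> stay_or_move G v r"
    by auto
  note attacked = neighbour_of_robber_attacked[OF free uv far]
  have vu: "v \<rightarrow>\<^bsub>G\<^esub> u"
    using uv dominates_sym by blast
  from nbr obtain x where x: "r \<rightarrow>\<^bsub>G\<^esub> x"
    by blast
  \<comment> \<open>If neither end dominates the neighbourhood of \<open>r\<close>, then
    \<open>v\<close> misses some \<open>y\<close> and \<open>u\<close> misses some \<open>z\<close>;
    by \<open>attacked\<close> each of these is adjacent to the other end.\<close>
  consider (u) "\<And>w. r \<rightarrow>\<^bsub>G\<^esub> w \<Longrightarrow> u \<rightarrow>\<^bsub>G\<^esub> w" | (v) "\<And>w. r \<rightarrow>\<^bsub>G\<^esub> w \<Longrightarrow> v \<rightarrow>\<^bsub>G\<^esub> w"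
    | (both) y z where "r \<rightarrow>\<^bsub>G\<^esub> y" "u \<rightarrow>\<^bsub>G\<^esub> y" "\<not> v \<rightarrow>\<^bsub>G\<^esub> y" "r \<rightarrow>\<^bsub>G\<^esub> z" "v \<rightarrow>\<^bsub>G\<^esub> z"
    using attacked by blast
  then show ?thesis
  proof cases
    case u
    with uv x show ?thesis
      by (rule catch_dominated)
  next
    case v
    with vu x show ?thesis
      by (intro catch_within_two_cops_swap[of G _ v u] catch_dominated)
  next
    case both
    from cyc consider "induced_free (with_proj (cycle_graph 3)) G"
      | "induced_free (with_proj (cycle_graph 4)) G" | "induced_free (with_proj (cycle_graph 5)) G"
      by blast
    then show ?thesis
    proof cases
      case 1
      from catch_triangle_free[OF free 1 uv far both(1,2,4,5)] show ?thesis .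
    next
      case 2
      from catch_four_cycle_free[OF free 2 uv far both(1,2)] show ?thesis .
    next
      case 3
      from catch_five_cycle_free[OF free 3 uv far both(1,2,3)] show ?thesis .
    qed
  qed
qed

lemma connected_has_neighbour:
  assumes "connected G" "a \<in> verts G" "b \<in> verts G" "a \<noteq> b"
  shows "\<exists>c. a \<rightarrow>\<^bsub>G\<^esub> c"
proof -
  have "strongly_connected G"
    using sym_arcs assms(1) by (rule symmetric_connected_imp_strongly_connected)
  then have "a \<rightarrow>\<^sup>*\<^bsub>G\<^esub> b"
    using assms by (auto simp: strongly_connected_def)
  then show ?thesis
    using assms(4) by (cases rule: converse_reachable_cases) auto
qed

lemma two_cops_win:
  assumes conn: "connected G"
    and free: "induced_free (with_proj two_K2) G"
    and cyc: "\<exists>k\<in>{3, 4, 5}. induced_free (with_proj (cycle_graph k)) G"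
  shows "cops_win G 2"
proof (cases "\<exists>u v. u \<rightarrow>\<^bsub>G\<^esub> v")
  case True
  then obtain u v where uv: "u \<rightarrow>\<^bsub>G\<^esub> v" by blast
  show ?thesis
  proof (rule cops_winI[where p = "two_cops u v"])
    show "two_cops u v i \<in> verts G" for i
      using uv by (auto simp: two_cops_def)
    fix r assume "r \<in> verts G"
    then have "\<exists>x. r \<rightarrow>\<^bsub>G\<^esub> x"
      using connected_has_neighbour[OF conn] uv by (metis adj_in_verts(1))
    then show "\<exists>n. catch_within G 2 n (two_cops u v) r"
      using catch_from_edge[OF free cyc uv] by blast
  qed
next
  case False
  \<comment> \<open>A connected graph without edges has a single vertex, on which both cops
    start.\<close>
  from conn obtain a where a: "a \<in> verts G"
    by (auto simp: connected_def strongly_connected_def)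
  show ?thesis
  proof (rule cops_winI[where p = "two_cops a a"])
    show "two_cops a a i \<in> verts G" for i
      using a by (simp add: two_cops_def)
    fix r assume "r \<in> verts G"
    then have "stay_or_move G a r"
      using connected_has_neighbour[OF conn a] False by (auto simp: stay_or_move_def)
    then show "\<exists>n. catch_within G 2 n (two_cops a a) r"
      by (blast intro: catch_within_two_cops_attacked)
  qed
qed

end

theorem theorem2:
  fixes G :: "('a, 'b) pre_digraph"
  assumes "graph G"
    and "Digraph_Component.connected G"
    and "induced_free (with_proj two_K2) G"
    and "\<exists>k\<in>{3, 4, 5}. induced_free (with_proj (cycle_graph k)) G"
  shows "cop_number G \<le> 2"
  unfolding cop_number_def
  using graph.two_cops_win[OF assms] by (rule Least_le)

end
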